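(* Let $H \in \mathbb{C}^{n\times n}$ be Hermitian positive definite and let $w \in \mathbb{C}^n$. Let the approximation $\widehat{w} \approx H^{-1}w$ be obtained in one of the following ways: (i) by performing $k \ge 1$ steps of the CG method for the system $Hy = w$ with initial guess $0$; (ii) by performing $k \geq 1$ steps of the preconditioned CG method for $Hy = w$ with initial guess $0$ and a Hermitian positive definite preconditioner $K \in \mathbb{C}^{n \times n}$; (iii) as $\widehat{w} = Gw$ with $G \in \mathbb{C}^{n \times n}$ Hermitian and positive definite. Then, if $w \neq 0$, the quantity $\langle w, \widehat{w}\rangle$ is real and $\langle w, \widehat{w}\rangle > 0$.
   Context: $\langle x,y\rangle = y^*x$ denotes the standard inner product on $\mathbb{C}^n$. For a matrix $M\in\mathbb{C}^{n\times n}$ and a vector $r\in\mathbb{C}^n$, $\mathcal{K}_k(M,r) = \mathrm{span}(r, Mr,\ldots,M^{k-1}r)$ is the Krylov subspace of order $k$. The result of $k$ steps of the CG method for $Hy=w$ with initial guess $0$ is the unique vector $\widehat{w}\in \mathcal{K}_k(H,w)$ such that $w - H\widehat{w}$ is orthogonal (in the standard inner product) to $\mathcal{K}_k(H,w)$. (If CG terminates with the exact solution before step $k$, this vector is the exact solution.) The result of $k$ steps of the preconditioned CG method for $Hy=w$ with initial guess $0$ and preconditioner $K$ is the unique vector $\widehat{w}\in \mathcal{K}_k(K^{-1}H,K^{-1}w)$ such that $w - H\widehat{w}$ is orthogonal (in the standard inner product) to $\mathcal{K}_k(K^{-1}H,K^{-1}w)$. *)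

theory Defs
  imports "HOL-Analysis.Analysis"
begin

text \<open>The inner product \<open>\<langle>x, y\<rangle> = y\<^sup>* x\<close>, conjugate-linear in the second argument.\<close>

definition cinner :: "complex ^ 'n \<Rightarrow> complex ^ 'n \<Rightarrow> complex"
  where "cinner x y = (\<Sum>i\<in>UNIV. cnj (y $ i) * x $ i)"

definition hermitian :: "complex ^ 'n ^ 'n \<Rightarrow> bool"
  where "hermitian A \<longleftrightarrow> (\<forall>i j. A $ i $ j = cnj (A $ j $ i))"

text \<open>For Hermitian \<open>A\<close> the number \<open>\<langle>A x, x\<rangle> = x\<^sup>* A x\<close> is real, so nothing is lost by taking \<open>Re\<close>.\<close>

definition hermitian_posdef :: "complex ^ 'n ^ 'n \<Rightarrow> bool"
  where "hermitian_posdef A \<longleftrightarrow> hermitian A \<and> (\<forall>x. x \<noteq> 0 \<longrightarrow> 0 < Re (cinner (A *v x) x))"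

text \<open>The span is over the complex scalars (\<open>vec.span\<close>); the unqualified \<open>span\<close> would be the
  real span.\<close>

definition krylov :: "nat \<Rightarrow> complex ^ 'n ^ 'n \<Rightarrow> complex ^ 'n \<Rightarrow> (complex ^ 'n) set"
  where "krylov k M r = vec.span ((\<lambda>i. ((*v) M ^^ i) r) ` {..<k})"

text \<open>The unique vector of \<open>S\<close> whose residual is orthogonal to \<open>S\<close>. It exists and is unique when \<open>H\<close>
  is Hermitian positive definite and \<open>S\<close> is a complex subspace.\<close>

definition galerkin :: "complex ^ 'n ^ 'n \<Rightarrow> complex ^ 'n \<Rightarrow> (complex ^ 'n) set \<Rightarrow> complex ^ 'n"
  where "galerkin H w S = (THE y. y \<in> S \<and> (\<forall>v\<in>S. cinner (w - H *v y) v = 0))"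

definition cg :: "nat \<Rightarrow> complex ^ 'n ^ 'n \<Rightarrow> complex ^ 'n \<Rightarrow> complex ^ 'n"
  where "cg k H w = galerkin H w (krylov k H w)"

definition pcg ::
    "nat \<Rightarrow> complex ^ 'n ^ 'n \<Rightarrow> complex ^ 'n ^ 'n \<Rightarrow> complex ^ 'n \<Rightarrow> complex ^ 'n"
  where "pcg k K H w = galerkin H w (krylov k (matrix_inv K ** H) (matrix_inv K *v w))"

end

theory Submission
  imports Defs
begin

text \<open>If the Galerkin vector \<open>y\<close> on a complex subspace \<open>S\<close> exists, then testing the residual
  against \<open>y\<close> itself gives \<open>\<langle>w, y\<rangle> = \<langle>H y, y\<rangle>\<close>, which is positive unless \<open>y = 0\<close>. But \<open>y = 0\<close> would
  make \<open>w\<close> orthogonal to \<open>S\<close>, whereas \<open>S\<close> contains \<open>P w\<close> with \<open>P\<close> positive definite (\<open>P = I\<close> for CG,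
  \<open>P = K\<^sup>-\<^sup>1\<close> for preconditioned CG). Existence is \<open>H\<close>-orthogonalisation, one spanning vector at a
  time.\<close>

lemma cinner_add_left: "cinner (x + y) z = cinner x z + cinner y z"
  by (simp add: cinner_def algebra_simps sum.distrib)

lemma cinner_diff_left: "cinner (x - y) z = cinner x z - cinner y z"
  by (simp add: cinner_def algebra_simps sum_subtractf)

lemma cinner_scale_left: "cinner (c *s x) y = c * cinner x y"
  by (simp add: cinner_def algebra_simps sum_distrib_left)

lemma cinner_add_right: "cinner x (y + z) = cinner x y + cinner x z"
  by (simp add: cinner_def algebra_simps sum.distrib)

lemma cinner_scale_right: "cinner x (c *s y) = cnj c * cinner x y"
  by (simp add: cinner_def algebra_simps sum_distrib_left)

lemma cinner_zero_right: "cinner x 0 = 0"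
  by (simp add: cinner_def)

lemma cinner_commute: "cinner y x = cnj (cinner x y)"
  by (simp add: cinner_def mult.commute)

lemma cinner_self_eq_0_iff: "cinner x x = 0 \<longleftrightarrow> x = 0"
proof
  assume "cinner x x = 0"
  moreover have "cinner x x = of_real (\<Sum>i\<in>UNIV. (cmod (x $ i))\<^sup>2)"
    unfolding cinner_def of_real_sum complex_norm_square by (simp add: mult.commute)
  ultimately have "(\<Sum>i\<in>UNIV. (cmod (x $ i))\<^sup>2) = 0"
    by (metis of_real_eq_0_iff)
  then show "x = 0"
    by (simp add: sum_nonneg_eq_0_iff vec_eq_iff)
qed (simp add: cinner_zero_right)

lemma hermitian_cinner:
  assumes "hermitian A"
  shows "cinner (A *v x) y = cinner x (A *v y)"
proof -
  have "cinner (A *v x) y = (\<Sum>i\<in>UNIV. \<Sum>j\<in>UNIV. cnj (y $ i) * (A $ i $ j * x $ j))"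
    by (simp add: cinner_def matrix_vector_mult_def sum_distrib_left)
  also have "\<dots> = (\<Sum>j\<in>UNIV. \<Sum>i\<in>UNIV. cnj (y $ i) * (A $ i $ j * x $ j))"
    by (rule sum.swap)
  also have "\<dots> = (\<Sum>j\<in>UNIV. \<Sum>i\<in>UNIV. cnj (A $ j $ i * y $ i) * x $ j)"
  proof (intro sum.cong refl)
    fix i j
    have "A $ i $ j = cnj (A $ j $ i)"
      using assms unfolding hermitian_def by blast
    then show "cnj (y $ i) * (A $ i $ j * x $ j) = cnj (A $ j $ i * y $ i) * x $ j"
      by simp
  qed
  also have "\<dots> = cinner x (A *v y)"
    by (simp add: cinner_def matrix_vector_mult_def sum_distrib_right)
  finally show ?thesis .
qed

text \<open>Moving \<open>A\<close> to the other argument and then using conjugate symmetry shows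
  that the number equals its own conjugate.\<close>

lemma hermitian_posdef_cinner:
  assumes "hermitian_posdef A" "x \<noteq> 0"
  shows "cinner (A *v x) x \<in> \<real>" "0 < Re (cinner (A *v x) x)"
proof -
  show "cinner (A *v x) x \<in> \<real>"
    using assms(1) hermitian_cinner cinner_commute
    by (metis Reals_cnj_iff hermitian_posdef_def)
  show "0 < Re (cinner (A *v x) x)"
    using assms by (simp add: hermitian_posdef_def)
qed

lemma hermitian_posdef_cinner_eq_0:
  assumes "hermitian_posdef A" "cinner (A *v x) x = 0"
  shows "x = 0"
  using hermitian_posdef_cinner(2)[OF assms(1), of x] assms(2) by auto

text \<open>Definiteness makes the kernel trivial, which for a square matrix gives invertibility.
  Since \<open>matrix_inv\<close> is a Hilbert choice, only then is it known to be an
  inverse.\<close>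

lemma hermitian_posdef_matrix_inv_right:
  assumes "hermitian_posdef K"
  shows "K *v (matrix_inv K *v x) = x"
proof -
  have "\<forall>x. K *v x = 0 \<longrightarrow> x = 0"
    using hermitian_posdef_cinner_eq_0[OF assms] by (simp add: cinner_def)
  then have "invertible K"
    using matrix_left_invertible_ker invertible_left_inverse by blast
  then have "K ** matrix_inv K = mat 1"
    unfolding invertible_def matrix_inv_def by (rule someI2_ex) simp
  then show ?thesis
    by (simp add: matrix_vector_mul_assoc)
qed

text \<open>The induction keeps \<open>w\<close> arbitrary because its hypothesis is used for two
  right-hand sides, \<open>w\<close> and \<open>H *v a\<close>.\<close>

lemma galerkin_exists:
  fixes H :: "complex ^ 'n ^ 'n"
  assumes "hermitian_posdef H" "finite B"
  shows "\<exists>y\<in>vec.span B. \<forall>v\<in>vec.span B. cinner (w - H *v y) v = 0"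
  using assms(2)
proof (induction B arbitrary: w rule: finite_induct)
  case empty
  then show ?case
    by (simp add: cinner_zero_right)
next
  case (insert a B)
  obtain y where y: "y \<in> vec.span B" "\<forall>v\<in>vec.span B. cinner (w - H *v y) v = 0"
    using insert.IH by blast
  \<comment> \<open>With right-hand side \<open>H *v a\<close>, the hypothesis yields the
    \<open>H\<close>-orthogonal projection \<open>p\<close> of \<open>a\<close> onto the span of
    \<open>B\<close>.\<close>
  obtain p where p: "p \<in> vec.span B" "\<forall>v\<in>vec.span B. cinner (H *v a - H *v p) v = 0"
    using insert.IH by blast
  define q where "q = a - p"
  \<comment> \<open>This step length makes the new residual orthogonal to \<open>q\<close>. If
    \<open>a\<close> already lies in the span of \<open>B\<close>, then \<open>q = 0\<close> and the
    quotient is 0 by convention.\<close>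
  define c where "c = cinner (w - H *v y) q / cinner (H *v q) q"
  have Hq: "cinner (H *v q) v = 0" if "v \<in> vec.span B" for v
    using p(2) that by (simp add: q_def matrix_vector_mult_diff_distrib)
  have sub: "vec.span B \<subseteq> vec.span (insert a B)"
    by (rule vec.span_mono) auto
  have "q \<in> vec.span (insert a B)"
    unfolding q_def using p(1) sub by (blast intro: vec.span_diff vec.span_base)
  then have mem: "y + c *s q \<in> vec.span (insert a B)"
    using y(1) sub by (blast intro: vec.span_add vec.span_scale)
  have res: "cinner (w - H *v (y + c *s q)) v = cinner (w - H *v y) v - c * cinner (H *v q) v" for v
    by (simp add: matrix_vector_right_distrib vector_scalar_commute cinner_diff_left
        cinner_add_left cinner_scale_left)
  have "cinner (w - H *v (y + c *s q)) q = 0"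
  proof (cases "q = 0")
    case False
    then have "cinner (H *v q) q \<noteq> 0"
      using hermitian_posdef_cinner_eq_0[OF assms(1)] by blast
    then show ?thesis
      unfolding res by (simp add: c_def)
  qed (simp add: cinner_zero_right)
  moreover have "cinner (w - H *v (y + c *s q)) v = 0" if "v \<in> vec.span B" for v
    unfolding res using Hq y(2) that by simp
  \<comment> \<open>As \<open>a\<close> and \<open>q\<close> differ by \<open>p\<close>, the
    enlarged span consists of the old one plus multiples of \<open>q\<close>, so the two
    orthogonality facts above suffice.\<close>
  moreover have "\<exists>u\<in>vec.span B. \<exists>k. v = u + k *s q" if v: "v \<in> vec.span (insert a B)" for v
  proof -
    obtain k where "v - k *s a \<in> vec.span B"
      using v vec.span_breakdown_eq by blast
    then have "(v - k *s a) + k *s p \<in> vec.span B"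
      using p(1) by (blast intro: vec.span_add vec.span_scale)
    moreover have "v = ((v - k *s a) + k *s p) + k *s q"
      by (simp add: q_def vec.scale_right_diff_distrib)
    ultimately show ?thesis by blast
  qed
  ultimately have "\<forall>v\<in>vec.span (insert a B). cinner (w - H *v (y + c *s q)) v = 0"
    by (metis cinner_add_right cinner_scale_right mult_zero_right add_0)
  then show ?case
    using mem by blast
qed

text \<open>The difference of the two residuals is \<open>H *v (y - z)\<close> up to sign. It is
  orthogonal to \<open>S\<close>, hence to \<open>y - z\<close> itself, and definiteness
  applies.\<close>

lemma galerkin_unique:
  assumes H: "hermitian_posdef H" and S: "vec.subspace S"
    and y: "y \<in> S" "\<forall>v\<in>S. cinner (w - H *v y) v = 0"
    and z: "z \<in> S" "\<forall>v\<in>S. cinner (w - H *v z) v = 0"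
  shows "y = z"
proof -
  have d: "y - z \<in> S"
    using S y(1) z(1) by (rule vec.subspace_diff)
  have "H *v (y - z) = (w - H *v z) - (w - H *v y)"
    by (simp add: matrix_vector_mult_diff_distrib)
  then have "cinner (H *v (y - z)) (y - z) = 0"
    using y(2) z(2) d by (simp add: cinner_diff_left)
  then show ?thesis
    using hermitian_posdef_cinner_eq_0[OF H] by fastforce
qed

text \<open>Existence and uniqueness together license the description operator in
  \<open>galerkin\<close>.\<close>

lemma galerkin_span:
  assumes "hermitian_posdef H" "finite B"
  shows "galerkin H w (vec.span B) \<in> vec.span B"
    and "\<forall>v\<in>vec.span B. cinner (w - H *v galerkin H w (vec.span B)) v = 0"
proof -
  have "\<exists>!y. y \<in> vec.span B \<and> (\<forall>v\<in>vec.span B. cinner (w - H *v y) v = 0)"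
    using galerkin_exists[OF assms, of w] galerkin_unique[OF assms(1) vec.subspace_span] by blast
  from theI'[OF this] show "galerkin H w (vec.span B) \<in> vec.span B"
    and "\<forall>v\<in>vec.span B. cinner (w - H *v galerkin H w (vec.span B)) v = 0"
    unfolding galerkin_def by blast+
qed

text \<open>Covers both iterations: \<open>r\<close> is \<open>w\<close> for CG and the
  preconditioned \<open>w\<close> for PCG. The condition on \<open>cinner w r\<close> is what
  excludes \<open>y = 0\<close>.\<close>

lemma galerkin_krylov_pos:
  fixes H M :: "complex ^ 'n ^ 'n"
  assumes H: "hermitian_posdef H" and "k \<ge> 1" and r: "cinner w r \<noteq> 0"
  defines "y \<equiv> galerkin H w (krylov k M r)"
  shows "cinner w y \<in> \<real> \<and> 0 < Re (cinner w y)"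
proof -
  have y: "y \<in> krylov k M r" "\<forall>v\<in>krylov k M r. cinner (w - H *v y) v = 0"
    unfolding y_def krylov_def using galerkin_span[OF H] by simp_all
  \<comment> \<open>The zeroth power is \<open>r\<close> itself; its index lies below
    \<open>k\<close> exactly because \<open>k \<ge> 1\<close>.\<close>
  have "((*v) M ^^ 0) r \<in> krylov k M r"
    unfolding krylov_def using \<open>k \<ge> 1\<close> by (intro vec.span_base imageI) simp
  then have "cinner (w - H *v y) r = 0"
    using y(2) by simp
  then have "y \<noteq> 0"
    using r by auto
  moreover have "cinner w y = cinner (H *v y) y"
    using y by (simp add: cinner_diff_left)
  ultimately show ?thesis
    using hermitian_posdef_cinner[OF H] by metis
qed

theorem proposition4p3:
  fixes H :: "complex ^ 'n ^ 'n" and w what :: "complex ^ 'n"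
  assumes "hermitian_posdef H"
    and "(\<exists>k\<ge>1. what = cg k H w)
       \<or> (\<exists>k\<ge>1. \<exists>K. hermitian_posdef K \<and> what = pcg k K H w)
       \<or> (\<exists>G. hermitian_posdef G \<and> what = G *v w)"
    and "w \<noteq> 0"
  shows "cinner w what \<in> \<real> \<and> 0 < Re (cinner w what)"
  using assms(2)
proof (elim disjE exE conjE)
  fix k :: nat
  assume "k \<ge> 1" "what = cg k H w"
  then show ?thesis
    using galerkin_krylov_pos[OF assms(1), of k w w H] assms(3)
    by (simp add: cg_def cinner_self_eq_0_iff)
next
  fix k :: nat and K
  assume k: "k \<ge> 1" and K: "hermitian_posdef K" and what: "what = pcg k K H w"
  define r where "r = matrix_inv K *v w"
  have w: "K *v r = w"
    unfolding r_def by (rule hermitian_posdef_matrix_inv_right[OF K])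
  then have "r \<noteq> 0"
    using assms(3) by auto
  \<comment> \<open>Writing \<open>w\<close> as \<open>K *v r\<close> turns this into definiteness
    of \<open>K\<close> at \<open>r\<close>, so positivity of the inverse never has to be
    shown.\<close>
  then have "cinner w r \<noteq> 0"
    using hermitian_posdef_cinner_eq_0[OF K] w by blast
  then show ?thesis
    using galerkin_krylov_pos[OF assms(1) k] by (simp add: what pcg_def r_def)
next
  fix G
  assume G: "hermitian_posdef G" and what: "what = G *v w"
  have "cinner w what = cinner (G *v w) w"
    using G by (simp add: what hermitian_cinner hermitian_posdef_def)
  then show ?thesis
    using hermitian_posdef_cinner[OF G assms(3)] by simp
qed

end
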